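(* Let $N\in\{2,3\}$ and let $g\in L^1([0,1])$ satisfy $g\ge0$ almost everywhere and $\operatorname{ess\,sup} g>0$. Then there exists $\lambda_1>0$ such that for every $\lambda>\lambda_1$ the singular boundary value problem $$-w''+(N-2)w'+(N-1)w=\frac{N-1}{2}e^{-t}w^2+\lambda e^{(N-3)t}\int_0^{e^{-t}}g(s)\,ds\quad(t>0),$$ $$w'(0)-(N-1)w(0)=0,\qquad\lim_{t\to\infty}w(t)=0,$$ has no weak solutions $w\in\tilde H^1_\mu$.
   Context: For $v:[0,\infty)\to\mathbb{R}$ put $\|v\|_\mu=\left(\int_0^\infty[(v')^2+v^2]e^{(2-N)t}\,dt\right)^{1/2}$. $\tilde H^1_\mu$ is the space of all measurable functions $v:[0,\infty)\to\mathbb{R}$ (with weak derivative $v'$) such that $\|v\|_\mu<\infty$. A weak solution is a $w\in\tilde H^1_\mu$ satisfying the equation in the sense of distributions on $(0,\infty)$ together with the boundary conditions; $w'(0)$ makes sense because the remaining terms of the equation are locally integrable on $[0,\infty)$, so $w'$ extends continuously to $t=0$. *)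

theory Defs
  imports "HOL-Probability.Essential_Supremum"
begin

definition test_function :: "(real \<Rightarrow> real) \<Rightarrow> bool" where
  "test_function \<phi> \<longleftrightarrow>
     (\<forall>k t. (deriv ^^ k) \<phi> differentiable (at t)) \<and>
     compact (closure {t. \<phi> t \<noteq> 0}) \<and> closure {t. \<phi> t \<noteq> 0} \<subseteq> {0<..}"

definition locally_integrable :: "(real \<Rightarrow> real) \<Rightarrow> bool" where
  "locally_integrable f \<longleftrightarrow>
     (\<forall>K. compact K \<longrightarrow> K \<subseteq> {0<..} \<longrightarrow> integrable (lebesgue_on K) f)"

definition has_weak_derivative :: "(real \<Rightarrow> real) \<Rightarrow> (real \<Rightarrow> real) \<Rightarrow> bool" where
  "has_weak_derivative w v \<longleftrightarrow>
     locally_integrable w \<and> locally_integrable v \<and>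
     (\<forall>\<phi>. test_function \<phi> \<longrightarrow>
        (\<integral>t. w t * deriv \<phi> t \<partial>lebesgue_on {0<..}) = - (\<integral>t. v t * \<phi> t \<partial>lebesgue_on {0<..}))"

(* The square of the weighted norm, with v in the role of the weak derivative of w;
   it lies in [0, \<infinity>], so finiteness of the norm is finiteness of this quantity. *)
definition mu_norm_sq :: "nat \<Rightarrow> (real \<Rightarrow> real) \<Rightarrow> (real \<Rightarrow> real) \<Rightarrow> ennreal" where
  "mu_norm_sq N w v =
     (\<integral>\<^sup>+t. ennreal (((v t)\<^sup>2 + (w t)\<^sup>2) * exp ((2 - real N) * t)) \<partial>lebesgue_on {0..})"

(* Functions on [0, \<infinity>) are represented by total functions whose values
   on the negative half-line are never used. *)
definition H1_mu :: "nat \<Rightarrow> (real \<Rightarrow> real) set" where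
  "H1_mu N = {w. w \<in> borel_measurable (lebesgue_on {0..}) \<and>
     (\<exists>v. has_weak_derivative w v \<and> mu_norm_sq N w v < \<infinity>)}"

(* All derivatives are moved onto the test function:
   the distributions w' and w'' act by \<phi> \<mapsto> - \<integral> w \<phi>' and \<phi> \<mapsto> \<integral> w \<phi>''. *)
definition solves_in_distributions ::
    "nat \<Rightarrow> (real \<Rightarrow> real) \<Rightarrow> real \<Rightarrow> (real \<Rightarrow> real) \<Rightarrow> bool" where
  "solves_in_distributions N g lam w \<longleftrightarrow>
     (\<forall>\<phi>. test_function \<phi> \<longrightarrow>
        (\<integral>t. w t * (- deriv (deriv \<phi>) t - (real N - 2) * deriv \<phi> t + (real N - 1) * \<phi> t)
           \<partial>lebesgue_on {0<..}) =
        (\<integral>t. ((real N - 1) / 2 * exp (- t) * (w t)\<^sup>2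
              + lam * exp ((real N - 3) * t) * (\<integral>s. g s \<partial>lebesgue_on {0..exp (- t)})) * \<phi> t
           \<partial>lebesgue_on {0<..}))"

definition continuous_version :: "(real \<Rightarrow> real) \<Rightarrow> (real \<Rightarrow> real) \<Rightarrow> bool" where
  "continuous_version f F \<longleftrightarrow>
     continuous_on {0..} F \<and> (AE t in lebesgue_on {0..}. F t = f t)"

(* w and its weak derivative v are determined only almost everywhere, so point values and
   the limit at infinity are those of the continuous versions W and V on [0, \<infinity>). These
   are unique on [0, \<infinity>), and they exist for every w in H1_mu N that solves the equation:
   w' is locally integrable up to 0, and so is w'' by the equation. *)
definition boundary_conditions :: "nat \<Rightarrow> (real \<Rightarrow> real) \<Rightarrow> bool" where
  "boundary_conditions N w \<longleftrightarrow>
     (\<exists>v W V. has_weak_derivative w v \<and> continuous_version w W \<and> continuous_version v V \<and>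
        V 0 - (real N - 1) * W 0 = 0 \<and> (W \<longlongrightarrow> 0) at_top)"

definition weak_solution ::
    "nat \<Rightarrow> (real \<Rightarrow> real) \<Rightarrow> real \<Rightarrow> (real \<Rightarrow> real) \<Rightarrow> bool" where
  "weak_solution N g lam w \<longleftrightarrow>
     w \<in> H1_mu N \<and> solves_in_distributions N g lam w \<and> boundary_conditions N w"

end

theory Submission
  imports Defs
begin

text \<open>
  Test the equation with \<open>\<phi> = F\<^sup>4\<close>, where \<open>F \<ge> 0\<close> is a smooth bump supported in an interval
  \<open>[a, b]\<close>, \<open>a > 0\<close>, on whose interior the source term \<open>h t = e\<^bsup>(N-3)t\<^esup> \<integral>\<^bsub>0\<^esub>\<^bsup>exp(-t)\<^esup> g\<close> is positive.
  The adjoint operator maps \<open>\<phi>\<close> to \<open>F\<^sup>2 K\<close> with \<open>K\<close> continuous, so with \<open>c = (N - 1) / 2\<close>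
  completing the square gives \<open>w F\<^sup>2 K \<le> c e\<^bsup>-t\<^esup> w\<^sup>2 \<phi> + e\<^sup>t K\<^sup>2 / (4c)\<close>. The quadratic terms
  cancel and \<open>\<lambda> \<integral> h \<phi> \<le> \<integral>\<^bsub>[a,b]\<^esub> e\<^sup>t K\<^sup>2 / (4c)\<close>, a bound independent of \<open>w\<close>.
\<close>

section \<open>Smooth functions flat at the origin\<close>

definition flat :: "nat \<Rightarrow> real \<Rightarrow> real" where
  "flat n x = (if x > 0 then (1 / x) ^ n * exp (- (1 / x)) else 0)"

text \<open>Under y = 1/x this is the decay of y^n e^(-y) at infinity.\<close>

lemma flat_tendsto_0: "(flat n \<longlongrightarrow> 0) (at_right 0)"
proof -
  have "((\<lambda>y::real. y ^ n / exp y) \<longlongrightarrow> 0) at_top"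
    by (rule tendsto_power_div_exp_0)
  then have "((\<lambda>x::real. inverse x ^ n / exp (inverse x)) \<longlongrightarrow> 0) (at_right 0)"
    by (rule filterlim_compose[OF _ filterlim_inverse_at_top_right])
  then show ?thesis
    by (rule Lim_transform_eventually)
      (auto simp: flat_def eventually_at_right_less exp_minus field_simps
        intro!: eventually_mono[OF eventually_at_right_less])
qed

text \<open>Away from 0 this is calculus. At 0 the left difference quotient is 0 and the right one
  is \<open>flat (Suc n)\<close>, which tends to 0. The powers of 1/x are built into
  \<open>flat\<close> so that derivatives stay in the span of the family, which starts with the
  classical e^(-1/x).\<close>

lemma flat_has_real_derivative:
  "(flat n has_real_derivative flat (Suc (Suc n)) x - real n * flat (Suc n) x) (at x)"
proof (cases x "0::real" rule: linorder_cases)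
  case less
  have "((\<lambda>_. 0) has_real_derivative 0) (at x)"
    by simp
  then have "(flat n has_real_derivative 0) (at x)"
    by (rule has_field_derivative_transform_within[where d = "-x"])
      (use less in \<open>auto simp: flat_def dist_real_def\<close>)
  then show ?thesis
    using less by (simp add: flat_def)
next
  case equal
  have "((\<lambda>y. (flat n y - flat n 0) / (y - 0)) \<longlongrightarrow> 0) (at_left 0)"
    by (rule Lim_transform_eventually[OF tendsto_const])
      (auto simp: flat_def eventually_at_left_field intro!: exI[of _ "-1"])
  moreover have "((\<lambda>y. (flat n y - flat n 0) / (y - 0)) \<longlongrightarrow> 0) (at_right 0)"
    by (rule Lim_transform_eventually[OF flat_tendsto_0[of "Suc n"]])
      (auto simp: flat_def field_simps intro!: eventually_mono[OF eventually_at_right_less])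
  ultimately have "((\<lambda>y. (flat n y - flat n 0) / (y - 0)) \<longlongrightarrow> 0) (at 0)"
    by (simp add: filterlim_split_at)
  then show ?thesis
    using equal by (simp add: has_field_derivative_iff flat_def)
next
  case greater
  have "((\<lambda>x. (1 / x) ^ n * exp (- (1 / x))) has_real_derivative
      flat (Suc (Suc n)) x - real n * flat (Suc n) x) (at x)"
  proof -
    define y where "y = 1 / x"
    have "((\<lambda>x. (1 / x) ^ n * exp (- (1 / x))) has_real_derivative
        real n * y ^ (n - 1) * - (y\<^sup>2) * exp (- y) + y\<^sup>2 * exp (- y) * y ^ n) (at x)"
      using greater by (auto intro!: derivative_eq_intros simp: y_def power2_eq_square)
    \<comment> \<open>For \<open>n = 0\<close> the truncated exponent \<open>n - 1\<close> does no
      harm, since the factor \<open>real n\<close> vanishes; hence the case split.\<close>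
    moreover have "real n * y ^ (n - 1) * - (y\<^sup>2) * exp (- y) + y\<^sup>2 * exp (- y) * y ^ n
        = flat (Suc (Suc n)) x - real n * flat (Suc n) x"
      using greater
      by (cases n) (simp_all add: flat_def power2_eq_square algebra_simps flip: y_def)
    ultimately show ?thesis
      by simp
  qed
  then show ?thesis
    by (rule has_field_derivative_transform_within[where d = x])
      (use greater in \<open>auto simp: flat_def dist_real_def\<close>)
qed

text \<open>A class of functions closed under differentiation, hence consisting of smooth functions,
  that contains compactly supported bumps.\<close>

inductive flat_algebra :: "(real \<Rightarrow> real) \<Rightarrow> bool" where
  flat_affine: "flat_algebra (\<lambda>t. flat n (c * t + d))"
| const: "flat_algebra (\<lambda>t. c)"
| add: "flat_algebra f \<Longrightarrow> flat_algebra g \<Longrightarrow> flat_algebra (\<lambda>t. f t + g t)"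
| mult: "flat_algebra f \<Longrightarrow> flat_algebra g \<Longrightarrow> flat_algebra (\<lambda>t. f t * g t)"

lemma flat_algebra_has_derivative:
  assumes "flat_algebra f"
  shows "\<exists>f'. flat_algebra f' \<and> (\<forall>t. (f has_real_derivative f' t) (at t))"
  using assms
proof induction
  case (flat_affine n c d)
  \<comment> \<open>The difference is written as a sum with the constant factor
    \<open>- real n\<close>, so that it is built from the rules of the algebra alone.\<close>
  let ?f' = "\<lambda>t. c * (flat (Suc (Suc n)) (c * t + d) + (- real n) * flat (Suc n) (c * t + d))"
  have "flat_algebra ?f'"
    by (intro flat_algebra.intros)
  moreover have "((\<lambda>t. flat n (c * t + d)) has_real_derivative ?f' t) (at t)" for t
    by (rule DERIV_cong, rule DERIV_chain2[where f = "flat n" and g = "\<lambda>t. c * t + d"],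
        rule flat_has_real_derivative) (auto intro!: derivative_eq_intros)
  ultimately show ?case
    by blast
next
  case (const c)
  show ?case
    by (rule exI[of _ "\<lambda>_. 0"]) (simp add: flat_algebra.const)
next
  case (add f g)
  then show ?case
    by (blast intro: flat_algebra.add DERIV_add)
next
  case (mult f g)
  then obtain f' g' where "flat_algebra f'" "flat_algebra g'"
    and "\<And>t. (f has_real_derivative f' t) (at t)" "\<And>t. (g has_real_derivative g' t) (at t)"
    by blast
  then show ?case
    using mult.hyps
    by (intro exI[of _ "\<lambda>t. f' t * g t + g' t * f t"])
      (auto intro!: flat_algebra.add flat_algebra.mult DERIV_mult)
qed

lemma flat_algebra_deriv: "flat_algebra f \<Longrightarrow> flat_algebra (deriv f)"
  by (metis DERIV_imp_deriv ext flat_algebra_has_derivative)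

lemma flat_algebra_DERIV: "flat_algebra f \<Longrightarrow> (f has_real_derivative deriv f t) (at t)"
  by (metis DERIV_imp_deriv flat_algebra_has_derivative)

lemma flat_algebra_continuous: "flat_algebra f \<Longrightarrow> continuous_on A f"
  by (meson DERIV_continuous_on flat_algebra_DERIV has_field_derivative_at_within)

lemma flat_algebra_smooth:
  assumes "flat_algebra f"
  shows "(deriv ^^ k) f differentiable (at t)"
proof -
  have "flat_algebra ((deriv ^^ k) f)"
    using assms by (induction k) (auto intro: flat_algebra_deriv)
  then show ?thesis
    using flat_algebra_DERIV real_differentiable_def by blast
qed

lemma test_function_flat_algebra:
  assumes "flat_algebra \<phi>" "\<And>t. t \<notin> {a..b} \<Longrightarrow> \<phi> t = 0" "0 < a"
  shows "test_function \<phi>"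
proof -
  have "closure {t. \<phi> t \<noteq> 0} \<subseteq> {a..b}"
    using assms(2) by (intro closure_minimal subsetI) (blast, simp)
  moreover from this have "compact (closure {t. \<phi> t \<noteq> 0})"
    by (meson bounded_closed_interval bounded_subset closed_closure compact_eq_bounded_closed)
  ultimately show ?thesis
    unfolding test_function_def using assms flat_algebra_smooth by force
qed

lemma bump_exists:
  fixes a b :: real
  shows "\<exists>F. flat_algebra F \<and> (\<forall>t. t \<notin> {a..b} \<longrightarrow> F t = 0) \<and> (\<forall>t. a < t \<and> t < b \<longrightarrow> 0 < F t)"
proof -
  \<comment> \<open>One factor vanishes for t \<le> a, the other for t \<ge> b. The affine arguments
    have the literal shape of rule \<open>flat_affine\<close>.\<close>
  let ?F = "\<lambda>t. flat 0 (1 * t + (- a)) * flat 0 (-1 * t + b)"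
  have "flat_algebra ?F"
    by (intro flat_algebra.intros)
  moreover have "\<forall>t. t \<notin> {a..b} \<longrightarrow> ?F t = 0" "\<forall>t. a < t \<and> t < b \<longrightarrow> 0 < ?F t"
    by (auto simp: flat_def)
  ultimately show ?thesis
    by blast
qed

section \<open>Integrability on compact intervals\<close>

lemma integrable_lebesgue_on_supported:
  fixes f :: "real \<Rightarrow> real"
  assumes "integrable (lebesgue_on S) u" "S \<in> sets lebesgue" "T \<in> sets lebesgue" "S \<subseteq> T"
    "\<And>t. t \<in> S \<Longrightarrow> f t = u t" "\<And>t. t \<in> T - S \<Longrightarrow> f t = 0"
  shows "integrable (lebesgue_on T) f"
proof -
  have "integrable lebesgue (\<lambda>t. indicator S t *\<^sub>R u t)"
    using assms by (simp add: integrable_restrict_space)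
  also have "(\<lambda>t. indicator S t *\<^sub>R u t) = (\<lambda>t. indicator T t *\<^sub>R f t)"
    using assms by (auto simp: indicator_def fun_eq_iff)
  finally show ?thesis
    using assms by (simp add: integrable_restrict_space)
qed

lemma integrable_mult_continuous:
  fixes u k :: "real \<Rightarrow> real"
  assumes "integrable (lebesgue_on {a..b}) u" "continuous_on {a..b} k"
  shows "integrable (lebesgue_on {a..b}) (\<lambda>t. u t * k t)"
proof -
  have "bounded (k ` {a..b})"
    using assms(2) by (intro compact_imp_bounded compact_continuous_image) auto
  then obtain B where B: "\<And>t. t \<in> {a..b} \<Longrightarrow> \<bar>k t\<bar> \<le> B"
    unfolding bounded_iff real_norm_def by blast
  have [measurable]: "k \<in> borel_measurable (lebesgue_on {a..b})"
    using assms(2) by (intro continuous_imp_measurable_on_sets_lebesgue) auto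
  have [measurable]: "u \<in> borel_measurable (lebesgue_on {a..b})"
    using assms(1) by auto
  show ?thesis
  proof (rule Bochner_Integration.integrable_bound)
    show "integrable (lebesgue_on {a..b}) (\<lambda>t. B * u t)"
      using assms(1) by simp
    show "AE t in lebesgue_on {a..b}. norm (u t * k t) \<le> norm (B * u t)"
    proof (rule AE_I2)
      fix t assume "t \<in> space (lebesgue_on {a..b})"
      then have "\<bar>k t\<bar> \<le> \<bar>B\<bar>"
        using B[of t] by auto
      then show "norm (u t * k t) \<le> norm (B * u t)"
        by (simp add: abs_mult mult.commute mult_right_mono)
    qed
  qed measurable
qed

text \<open>On a bounded interval the reciprocal of the weight is continuous, so the weight can be
  divided out of the norm; then |w| \<le> 1 + w^2 handles \<open>w\<close> itself. This ensures that
  the integrals of the tested equation are genuine and may be split.\<close>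

lemma H1_mu_integrable:
  assumes "w \<in> H1_mu N" "0 \<le> a"
  shows "integrable (lebesgue_on {a..b}) (\<lambda>t. (w t)\<^sup>2)" (is ?sq)
    and "integrable (lebesgue_on {a..b}) w" (is ?id)
proof -
  from assms obtain v where meas: "w \<in> borel_measurable (lebesgue_on {0..})"
    and fin: "mu_norm_sq N w v < \<infinity>"
    unfolding H1_mu_def by auto
  have sub: "{a..b} \<subseteq> {0..}"
    using assms(2) by auto
  have [measurable]: "w \<in> borel_measurable (lebesgue_on {a..b})"
    using measurable_restrict_mono[OF meas sub] .
  have [measurable]: "(\<lambda>t. exp ((2 - real N) * t)) \<in> borel_measurable (lebesgue_on {a..b})"
    by (intro continuous_imp_measurable_on_sets_lebesgue continuous_intros) auto
  have "(\<integral>\<^sup>+t. ennreal ((w t)\<^sup>2 * exp ((2 - real N) * t)) \<partial>lebesgue_on {a..b})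
      \<le> mu_norm_sq N w v"
    unfolding mu_norm_sq_def using sub
    by (auto simp: nn_integral_restrict_space indicator_def intro!: nn_integral_mono ennreal_leI)
  with fin have "integrable (lebesgue_on {a..b}) (\<lambda>t. (w t)\<^sup>2 * exp ((2 - real N) * t))"
    by (intro integrableI_nonneg) auto
  from integrable_mult_continuous[OF this, of "\<lambda>t. exp (- ((2 - real N) * t))"]
  show ?sq
    by (simp add: mult.assoc exp_minus_inverse continuous_intros)
  then have "integrable (lebesgue_on {a..b}) (\<lambda>t. 1 + (w t)\<^sup>2)"
    by (auto simp: finite_measure.integrable_const finite_measure_lebesgue_on)
  then show ?id
  proof (rule Bochner_Integration.integrable_bound)
    have "\<bar>x\<bar> \<le> 1 + x\<^sup>2" for x :: real
      using sum_squares_bound[of "\<bar>x\<bar>" 1] by simp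
    then show "AE t in lebesgue_on {a..b}. norm (w t) \<le> norm (1 + (w t)\<^sup>2)"
      by simp
  qed measurable
qed

section \<open>Primitives and positivity of integrals\<close>

lemma essentially_positive_integral:
  fixes g :: "real \<Rightarrow> real"
  assumes g: "integrable (lebesgue_on {0..1}) g" "AE s in lebesgue_on {0..1}. 0 \<le> g s"
    and pos: "esssup (lebesgue_on {0..1}) (\<lambda>s. ereal (g s)) > 0"
  shows "(\<integral>s. g s \<partial>lebesgue_on {0..1}) > 0"
proof (rule ccontr)
  assume "\<not> ?thesis"
  moreover have "(\<integral>s. g s \<partial>lebesgue_on {0..1}) \<ge> 0"
    using g(2) by (rule integral_nonneg_AE)
  \<comment> \<open>A nonnegative function with zero integral vanishes almost everywhere, which
    would push the essential supremum down to at most 0.\<close>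
  ultimately have "AE s in lebesgue_on {0..1}. g s = 0"
    using integral_nonneg_eq_0_iff_AE[OF g] by simp
  then have "AE s in lebesgue_on {0..1}. ereal (g s) \<le> 0"
    by eventually_elim simp
  moreover have "(\<lambda>s. ereal (g s)) \<in> borel_measurable (lebesgue_on {0..1})"
    using g(1) by auto
  ultimately have "esssup (lebesgue_on {0..1}) (\<lambda>s. ereal (g s)) \<le> 0"
    by (intro esssup_I)
  with pos show False
    by simp
qed

lemma indefinite_integral_continuous:
  fixes g :: "real \<Rightarrow> real"
  assumes "integrable (lebesgue_on {a..b}) g"
  shows "continuous_on {a..b} (\<lambda>r. \<integral>s. g s \<partial>lebesgue_on {a..r})"
proof -
  have "(\<integral>s. g s \<partial>lebesgue_on {a..r}) = integral {a..r} g" if "r \<in> {a..b}" for r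
    using that by (intro lebesgue_integral_eq_integral integrable_subinterval[OF assms]) auto
  moreover have "continuous_on {a..b} (\<lambda>r. integral {a..r} g)"
    using assms by (intro indefinite_integral_continuous_1 integrable_on_lebesgue_on) auto
  ultimately show ?thesis
    by (subst continuous_on_cong[OF refl]) auto
qed

lemma indefinite_integral_mono:
  fixes g :: "real \<Rightarrow> real"
  assumes "integrable (lebesgue_on {a..b}) g" "AE s in lebesgue_on {a..b}. 0 \<le> g s"
    and "r \<le> r'" "r' \<le> b"
  shows "(\<integral>s. g s \<partial>lebesgue_on {a..r}) \<le> (\<integral>s. g s \<partial>lebesgue_on {a..r'})"
proof -
  have int: "integrable lebesgue (\<lambda>s. indicator {a..x} s *\<^sub>R g s)" if "x \<le> b" for x
    using integrable_subinterval[OF assms(1), of a x] that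
    by (auto simp: integrable_restrict_space)
  have "AE s in lebesgue. s \<in> {a..b} \<longrightarrow> 0 \<le> g s"
    using assms(2) by (simp add: AE_restrict_space_iff)
  then have "AE s in lebesgue. indicator {a..r} s *\<^sub>R g s \<le> indicator {a..r'} s *\<^sub>R g s"
    by eventually_elim (use assms in \<open>auto simp: indicator_def\<close>)
  then show ?thesis
    using int assms by (auto simp: integral_restrict_space intro!: integral_mono_AE)
qed

lemma integral_pos_on_interval:
  fixes f :: "real \<Rightarrow> real"
  assumes "integrable (lebesgue_on T) f" "T \<in> sets lebesgue" "\<And>t. t \<in> T \<Longrightarrow> 0 \<le> f t"
    and "a < b" "{a<..<b} \<subseteq> T" "\<And>t. a < t \<Longrightarrow> t < b \<Longrightarrow> 0 < f t"
  shows "0 < (\<integral>t. f t \<partial>lebesgue_on T)"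
proof (rule ccontr)
  have nn: "AE t in lebesgue_on T. 0 \<le> f t"
    using assms by (intro AE_I2) auto
  assume "\<not> ?thesis"
  then have "(\<integral>t. f t \<partial>lebesgue_on T) = 0"
    using integral_nonneg_AE[OF nn] by simp
  then have "AE t in lebesgue_on T. f t = 0"
    using integral_nonneg_eq_0_iff_AE[OF assms(1) nn] by simp
  then have "AE t in lebesgue. t \<in> T \<longrightarrow> f t = 0"
    using assms by (simp add: AE_restrict_space_iff)
  then have "AE t in lebesgue. t \<notin> {a<..<b}"
    by eventually_elim (use assms in force)
  then have "{a<..<b} \<in> null_sets lebesgue"
    by (subst AE_iff_null_sets) auto
  then show False
    using assms(4) by (simp add: null_sets_def)
qed

theorem theorem6p5:
  fixes N :: nat and g :: "real \<Rightarrow> real"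
  assumes "N \<in> {2, 3}"
    and "integrable (lebesgue_on {0..1}) g"
    and "AE s in lebesgue_on {0..1}. 0 \<le> g s"
    and "esssup (lebesgue_on {0..1}) (\<lambda>s. ereal (g s)) > 0"
  shows "\<exists>lam1>0. \<forall>lam>lam1. \<not> (\<exists>w. weak_solution N g lam w)"
proof -

  \<comment> \<open>Positivity of the source term for small t\<close>
  define G where "G r = (\<integral>s. g s \<partial>lebesgue_on {0..r})" for r :: real
  define h where "h t = exp ((real N - 3) * t) * G (exp (- t))" for t
  define c where "c = (real N - 1) / 2"
  have c: "c > 0"
    using assms(1) by (auto simp: c_def)
  have cont_G: "continuous_on {0..1} G"
    unfolding G_def using assms(2) by (rule indefinite_integral_continuous)
  have G_mono: "G r \<le> G r'" if "r \<le> r'" "r' \<le> 1" for r r'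
    unfolding G_def using indefinite_integral_mono[OF assms(2,3) that] .
  \<comment> \<open>\<open>G (-1)\<close> is an integral over the empty set, hence 0, and serves as
    the lower comparison value.\<close>
  have G_nonneg: "0 \<le> G r" if "0 \<le> r" "r \<le> 1" for r
    using G_mono[of "-1" r] that by (simp add: G_def integral_restrict_space)
  have "0 < G 1"
    unfolding G_def using assms(2-4) by (rule essentially_positive_integral)
  moreover have "(G \<longlongrightarrow> G 1) (at 1 within {0..1})"
    using cont_G by (simp add: continuous_on)
  then have "(G \<longlongrightarrow> G 1) (at_left 1)"
    by (simp add: at_within_Icc_at_left)
  ultimately have "\<forall>\<^sub>F r in at_left 1. 0 < G r"
    by (simp add: order_tendstoD)
  then obtain r0 where "r0 < 1" and r0: "\<And>r. r0 < r \<Longrightarrow> r < 1 \<Longrightarrow> 0 < G r"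
    unfolding eventually_at_left_field by blast
  \<comment> \<open>Continuity of \<open>G\<close> at 1 provides a point strictly below 1 with
    \<open>G\<close> positive. Taking the maximum with 0 keeps \<open>r\<close> positive, so that
    \<open>- ln r\<close> is a positive number.\<close>
  define r where "r = (max r0 0 + 1) / 2"
  have r: "0 < r" "r < 1" "0 < G r"
    using \<open>r0 < 1\<close> by (auto simp: r_def intro!: r0)
  \<comment> \<open>For 0 < t < b the point e^(-t) lies between \<open>r\<close> and 1, so
    monotonicity carries positivity over from \<open>G r\<close>. The choice of \<open>a\<close>
    keeps the support of the test function away from 0.\<close>
  define b where "b = - ln r"
  define a where "a = b / 2"
  have ab: "0 < a" "a < b"
    using r by (auto simp: a_def b_def)
  have h_nonneg: "0 \<le> h t" if "0 < t" for t
    using that by (auto simp: h_def intro!: mult_nonneg_nonneg G_nonneg)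
  have h_pos: "0 < h t" if "0 < t" "t < b" for t
  proof -
    have "r \<le> exp (- t)"
      using that r(1) ln_le_cancel_iff[of r "exp (- t)"] by (simp add: b_def)
    then have "0 < G (exp (- t))"
      using r(3) G_mono[of r "exp (- t)"] that by simp
    then show ?thesis
      by (simp add: h_def)
  qed
  have cont_h: "continuous_on {a..b} h"
    unfolding h_def using ab
    by (intro continuous_intros continuous_on_compose2[OF cont_G]) auto

  \<comment> \<open>The test function and its image under the adjoint operator\<close>
  obtain F where F: "flat_algebra F" "\<And>t. t \<notin> {a..b} \<Longrightarrow> F t = 0"
    "\<And>t. a < t \<Longrightarrow> t < b \<Longrightarrow> 0 < F t"
    using bump_exists[of a b] by blast
  define F1 where "F1 = deriv F"
  define F2 where "F2 = deriv F1"
  have F12: "flat_algebra F1" "flat_algebra F2"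
    using F(1) by (auto simp: F1_def F2_def intro: flat_algebra_deriv)
  note cont_F = flat_algebra_continuous[OF F(1)] flat_algebra_continuous[OF F12(1)]
    flat_algebra_continuous[OF F12(2)]
  have dF: "(F has_real_derivative F1 t) (at t)" "(F1 has_real_derivative F2 t) (at t)" for t
    using F(1) F12 by (auto simp: F1_def F2_def intro: flat_algebra_DERIV flat_algebra_deriv)
  \<comment> \<open>Two derivatives cost at most two of the four factors \<open>F\<close>, so a
    factor F^2, the square root of \<open>\<phi>\<close>, survives. Hence the square of the image
    divided by \<open>\<phi>\<close> is K^2, which stays bounded where \<open>F\<close>
    vanishes.\<close>
  define \<phi> where "\<phi> t = (F t * F t) * (F t * F t)" for t
  have phi: "test_function \<phi>"
    using F ab unfolding \<phi>_def
    by (intro test_function_flat_algebra[of _ a b] flat_algebra.mult) auto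
  have phi_pos: "0 < \<phi> t" if "a < t" "t < b" for t
    using F(3)[OF that] by (simp add: \<phi>_def)
  have phi_nonneg: "0 \<le> \<phi> t" for t
    by (simp add: \<phi>_def)
  have d1: "deriv \<phi> = (\<lambda>t. 4 * F t ^ 3 * F1 t)"
    unfolding \<phi>_def
    by (intro ext DERIV_imp_deriv)
      (auto intro!: derivative_eq_intros dF simp: power3_eq_cube algebra_simps)
  have d2: "deriv (deriv \<phi>) = (\<lambda>t. 12 * (F t)\<^sup>2 * (F1 t)\<^sup>2 + 4 * F t ^ 3 * F2 t)"
    unfolding d1
    by (intro ext DERIV_imp_deriv)
      (auto intro!: derivative_eq_intros dF simp: power2_eq_square power3_eq_cube algebra_simps)
  define K where "K t = - 12 * (F1 t)\<^sup>2 - 4 * F t * F2 t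
      - 4 * (real N - 2) * F t * F1 t + (real N - 1) * (F t)\<^sup>2" for t
  have LK: "- deriv (deriv \<phi>) t - (real N - 2) * deriv \<phi> t + (real N - 1) * \<phi> t = (F t)\<^sup>2 * K t"
    for t
    unfolding d2 unfolding d1 \<phi>_def K_def
    by (simp add: power2_eq_square power3_eq_cube algebra_simps)

  \<comment> \<open>The indicator confines the remainder to \<open>[a, b]\<close>, where continuity
    of \<open>K\<close> gives integrability.\<close>
  define R where "R t = indicator {a..b} t * (exp t * (K t)\<^sup>2 / (4 * c))" for t
  define B where "B = (\<integral>t. h t * \<phi> t \<partial>lebesgue_on {0<..})"
  define C where "C = (\<integral>t. R t \<partial>lebesgue_on {0<..})"
  have extend: "integrable (lebesgue_on {0<..}) f"
    if "integrable (lebesgue_on {a..b}) f" "\<And>t. t \<notin> {a..b} \<Longrightarrow> f t = 0" for f :: "real \<Rightarrow> real"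
    by (rule integrable_lebesgue_on_supported[OF that(1)]) (use ab that(2) in auto)
  have cont_phi: "continuous_on {a..b} \<phi>"
    unfolding \<phi>_def by (intro continuous_intros cont_F)
  have cont_K: "continuous_on {a..b} K"
    unfolding K_def by (intro continuous_intros cont_F)
  have int_R: "integrable (lebesgue_on {0<..}) R"
  proof (rule integrable_lebesgue_on_supported)
    show "integrable (lebesgue_on {a..b}) (\<lambda>t. exp t * (K t)\<^sup>2 / (4 * c))"
      using c by (intro continuous_imp_integrable_real continuous_intros cont_K) auto
  qed (use ab in \<open>auto simp: R_def\<close>)
  have int_h: "integrable (lebesgue_on {0<..}) (\<lambda>t. h t * \<phi> t)"
    using F(2)
    by (intro extend continuous_imp_integrable_real continuous_intros cont_h cont_phi)
      (auto simp: \<phi>_def)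
  have B: "0 < B"
    unfolding B_def using ab
    by (intro integral_pos_on_interval[OF int_h, of a b])
      (auto intro!: mult_nonneg_nonneg[OF h_nonneg] mult_pos_pos[OF h_pos] phi_nonneg phi_pos)
  have C: "0 \<le> C"
    unfolding C_def R_def using c by (intro Bochner_Integration.integral_nonneg) auto

  \<comment> \<open>The bound on lambda for an arbitrary weak solution\<close>
  have "lam * B \<le> C" if sol: "weak_solution N g lam w" for lam w
  proof -
    have w: "w \<in> H1_mu N" and eq: "solves_in_distributions N g lam w"
      using sol by (auto simp: weak_solution_def)
    have wab: "integrable (lebesgue_on {a..b}) (\<lambda>t. (w t)\<^sup>2)" "integrable (lebesgue_on {a..b}) w"
      using H1_mu_integrable[OF w] ab by auto
    define Q where "Q t = c * exp (- t) * (w t)\<^sup>2 * \<phi> t" for t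
    have "integrable (lebesgue_on {a..b}) (\<lambda>t. (w t)\<^sup>2 * (c * exp (- t) * \<phi> t))"
      by (intro integrable_mult_continuous wab continuous_intros cont_phi)
    then have int_Q: "integrable (lebesgue_on {0<..}) Q"
      using F(2) unfolding Q_def by (intro extend) (auto simp: \<phi>_def mult_ac)
    have int_L: "integrable (lebesgue_on {0<..}) (\<lambda>t. w t * ((F t)\<^sup>2 * K t))"
      using F(2)
      by (intro extend integrable_mult_continuous wab continuous_intros cont_F cont_K) auto
    have "(\<integral>t. w t * ((F t)\<^sup>2 * K t) \<partial>lebesgue_on {0<..})
        = (\<integral>t. Q t + lam * (h t * \<phi> t) \<partial>lebesgue_on {0<..})"
      using eq[unfolded solves_in_distributions_def, rule_format, OF phi, unfolded LK]
      by (simp add: Q_def h_def G_def c_def algebra_simps)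
    also have "\<dots> = (\<integral>t. Q t \<partial>lebesgue_on {0<..}) + lam * B"
      using int_Q int_h by (simp add: B_def)
    finally have "(\<integral>t. Q t \<partial>lebesgue_on {0<..}) + lam * B
        = (\<integral>t. w t * ((F t)\<^sup>2 * K t) \<partial>lebesgue_on {0<..})" ..
    also have "\<dots> \<le> (\<integral>t. Q t + R t \<partial>lebesgue_on {0<..})"
    proof (rule integral_mono[OF int_L])
      fix t :: real
      \<comment> \<open>With y = w F^2, the quadratic c e^(-t) y^2 - K y is minimal at y = e^t K /
        (2c), where its value is -e^t K^2 / (4c).\<close>
      have "0 \<le> c * exp (- t) * (w t * (F t)\<^sup>2 - exp t * K t / (2 * c))\<^sup>2"
        using c by simp
      also have "\<dots> = Q t + exp t * (K t)\<^sup>2 / (4 * c) - w t * ((F t)\<^sup>2 * K t)"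
        using c unfolding Q_def \<phi>_def
        by (simp add: exp_minus power2_eq_square field_simps)
      finally show "w t * ((F t)\<^sup>2 * K t) \<le> Q t + R t"
        \<comment> \<open>Outside \<open>[a, b]\<close> the inequality reads 0 \<le> 0, because
          \<open>F\<close> and the indicator vanish there.\<close>
        using F(2)[of t] by (cases "t \<in> {a..b}") (auto simp: R_def Q_def \<phi>_def)
    qed (use int_Q int_R in simp)
    also have "\<dots> = (\<integral>t. Q t \<partial>lebesgue_on {0<..}) + C"
      using int_Q int_R by (simp add: C_def)
    finally show ?thesis
      by simp
  qed
  \<comment> \<open>Only 0 \<le> C has been shown; adding 1 to C / B makes the threshold strictly
    positive.\<close>
  then have "\<not> weak_solution N g lam w" if "lam > C / B + 1" for lam w
    using that B by (fastforce simp: field_simps)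
  moreover have "C / B + 1 > 0"
    using B C by (simp add: add_nonneg_pos)
  ultimately show ?thesis
    by blast
qed

end
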